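(* Let $F$ be an ordered graph with $v(F)\geq 3$ and $F\notin\{D,D^{\leftarrow},\overline{D},\overline{D^{\leftarrow}}\}$. Then there is a constant $c>0$ such that for every sufficiently small $\varepsilon>0$ and every $n>n_0(\varepsilon)$ there is an $n$-vertex ordered graph $G$ which is $\varepsilon$-far from being induced $F$-free but contains at most $\varepsilon^{c\log(1/\varepsilon)}n^{v(F)}$ induced copies of $F$.
   Context: An ordered graph is a graph with a linear order on its vertex set; an induced copy of $H$ in $G$ is given by an order-preserving injection $V(H)\to V(G)$ mapping edges to edges and non-edges to non-edges. An $n$-vertex ordered graph is $\varepsilon$-far from being induced $F$-free if one must add/delete at least $\varepsilon n^2$ edges to obtain an ordered graph with no induced copy of $F$. $D$ is the ordered graph with vertices $x<y<z$ and edges $\{x,y\},\{x,z\}$; $\overline{G}$ is the complement of $G$ and $G^{\leftarrow}$ is $G$ with the vertex order reversed. *)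

theory Defs
  imports Complex_Main "HOL-Library.FuncSet"
begin

text \<open>
  The linear order is part of the graph (reflexive, as a relation on the vertex set), and an
  edge is a two-element set of vertices. All graphs are finite and simple.
\<close>

record 'a ordered_graph =
  verts :: "'a set"
  edges :: "'a set set"
  vorder :: "('a \<times> 'a) set"

definition all_pairs :: "'a set \<Rightarrow> 'a set set" where
  "all_pairs V = {{x, y} | x y. x \<in> V \<and> y \<in> V \<and> x \<noteq> y}"

definition is_ordered_graph :: "'a ordered_graph \<Rightarrow> bool" where
  "is_ordered_graph G \<longleftrightarrow>
     finite (verts G) \<and> edges G \<subseteq> all_pairs (verts G) \<and>
     linear_order_on (verts G) (vorder G)"

definition complement :: "'a ordered_graph \<Rightarrow> 'a ordered_graph" where
  "complement G = G\<lparr>edges := all_pairs (verts G) - edges G\<rparr>"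

definition order_reversal :: "'a ordered_graph \<Rightarrow> 'a ordered_graph" where
  "order_reversal G = G\<lparr>vorder := (vorder G)\<inverse>\<rparr>"

text \<open>
  Copies are extensional functions on the vertex set, so that two copies agreeing on
  the vertices of \<open>F\<close> are equal and copies can be counted.
\<close>

definition induced_copies ::
    "'a ordered_graph \<Rightarrow> 'b ordered_graph \<Rightarrow> ('a \<Rightarrow> 'b) set" where
  "induced_copies F G =
     {f \<in> verts F \<rightarrow>\<^sub>E verts G.
        inj_on f (verts F) \<and>
        (\<forall>x\<in>verts F. \<forall>y\<in>verts F. (x, y) \<in> vorder F \<longrightarrow> (f x, f y) \<in> vorder G) \<and>
        (\<forall>x\<in>verts F. \<forall>y\<in>verts F. x \<noteq> y \<longrightarrow>
           ({x, y} \<in> edges F \<longleftrightarrow> {f x, f y} \<in> edges G))}"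

definition ordered_iso :: "'a ordered_graph \<Rightarrow> 'b ordered_graph \<Rightarrow> bool" where
  "ordered_iso F G \<longleftrightarrow> (\<exists>f \<in> induced_copies F G. f ` verts F = verts G)"

definition induced_free :: "'a ordered_graph \<Rightarrow> 'b ordered_graph \<Rightarrow> bool" where
  "induced_free F G \<longleftrightarrow> induced_copies F G = {}"

text \<open>
  Only edges may be modified: the competitor \<open>H\<close> has the same vertices in the same order.
\<close>

definition far_from_induced_free ::
    "real \<Rightarrow> 'a ordered_graph \<Rightarrow> 'b ordered_graph \<Rightarrow> bool" where
  "far_from_induced_free \<epsilon> F G \<longleftrightarrow>
     (\<forall>H. is_ordered_graph H \<and> verts H = verts G \<and> vorder H = vorder G \<and> induced_free F H \<longrightarrow>
        real (card (sym_diff (edges G) (edges H))) \<ge> \<epsilon> * (real (card (verts G)))\<^sup>2)"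

definition graph_D :: "nat ordered_graph" where
  "graph_D = \<lparr>verts = {0, 1, 2}, edges = {{0, 1}, {0, 2}},
              vorder = {(i, j). i \<le> j \<and> j \<le> 2}\<rparr>"

lemma is_ordered_graph_D: "is_ordered_graph graph_D"
proof -
  have pair: "{x, y} \<in> all_pairs V" if "x \<in> V" "y \<in> V" "x \<noteq> y" for x y :: nat and V
    using that unfolding all_pairs_def by blast
  have edges: "{{0, 1}, {0, 2}} \<subseteq> all_pairs {0, 1, 2 :: nat}"
    by (simp add: pair)
  have V: "{0, 1, 2} = {..2 :: nat}"
    by auto
  have "linear_order_on {..2} {(i, j). i \<le> j \<and> j \<le> (2 :: nat)}"
    unfolding order_on_defs refl_on_def trans_def antisym_def total_on_def
    by (safe; simp)
  with edges show ?thesis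
    unfolding is_ordered_graph_def graph_D_def by (simp only: ordered_graph.simps V) simp
qed

lemma is_ordered_graph_complement: "is_ordered_graph G \<Longrightarrow> is_ordered_graph (complement G)"
  by (simp add: is_ordered_graph_def complement_def)

lemma is_ordered_graph_order_reversal:
  "is_ordered_graph G \<Longrightarrow> is_ordered_graph (order_reversal G)"
  by (simp add: is_ordered_graph_def order_reversal_def)

end

theory Submission
  imports Defs
begin

text \<open>
  Number the vertices of \<open>F\<close> increasingly by \<open>0, \<dots>, k - 1\<close>. Since \<open>F\<close> is none of the four
  exceptional graphs, two of the pairs \<open>01\<close>, \<open>12\<close>, \<open>23\<close> agree in being edges or non-edges; call the
  pairs of that kind pattern pairs. So there is a sequence of two pattern pairs, each
  starting no earlier than the previous one ends; let \<open>T \<ge> 2\<close> be the maximal length of such a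
  chain. A vertex is a core vertex of level \<open>s\<close> if a chain of length \<open>s\<close> ends at or before it and one
  of length \<open>T - s\<close> starts at or after it.

  The host graph has consecutive parts \<open>V\<^sub>0 < \<dots> < V\<^sub>k\<^sub>-\<^sub>1\<close> without pattern pairs inside the parts.
  Two parts are joined uniformly as in \<open>F\<close>, except that for core vertices \<open>p < q\<close> of different
  levels only the pairs of positions \<open>(x + p d, x + q d)\<close> with \<open>d\<close> in a Behrend set are joined as in
  \<open>F\<close>, and all the others are joined in the opposite way. Every copy of \<open>F\<close> induces a monotone map from
  \<open>{0, \<dots>, k - 1}\<close> to itself, and maximality of \<open>T\<close> forces it to preserve each core level. Hence it
  has fixed points on the levels 0, 1 and 2, and these three vertices form a Behrend triangle,
  which costs a factor of the number of positions. On the other hand the arithmetic progressions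
  with difference in the Behrend set provide many pair-disjoint copies of \<open>F\<close>.
\<close>

subsection \<open>Behrend sets\<close>

text \<open>Reduction modulo \<open>B\<close> isolates the lowest digit. This gives both the
  injectivity of the encoding \<open>num\<close> and the digitwise reading of a linear
  relation.\<close>

lemma digits_unique:
  fixes u w :: "nat \<Rightarrow> nat"
  assumes "(\<Sum>i<D. u i * B ^ i) = (\<Sum>i<D. w i * B ^ i)"
    and "\<And>i. i < D \<Longrightarrow> u i < B" "\<And>i. i < D \<Longrightarrow> w i < B" and "i < D"
  shows "u i = w i"
  using assms
proof (induction D arbitrary: u w i)
  case 0
  then show ?case by simp
next
  case (Suc D)
  have shift: "(\<Sum>i<Suc D. v i * B ^ i) = v 0 + B * (\<Sum>i<D. v (Suc i) * B ^ i)"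
    for v :: "nat \<Rightarrow> nat"
    by (subst sum.lessThan_Suc_shift) (simp add: sum_distrib_left mult_ac)
  have eq: "u 0 + B * (\<Sum>i<D. u (Suc i) * B ^ i) = w 0 + B * (\<Sum>i<D. w (Suc i) * B ^ i)"
    using Suc.prems(1) unfolding shift .
  have lt: "u 0 < B" "w 0 < B" using Suc.prems by auto
  have 0: "u 0 = w 0"
    using arg_cong[OF eq, of "\<lambda>x. x mod B"] lt by simp
  with eq lt have "(\<Sum>i<D. u (Suc i) * B ^ i) = (\<Sum>i<D. w (Suc i) * B ^ i)" by simp
  then have "u (Suc j) = w (Suc j)" if "j < D" for j
    using that Suc.IH[of "\<lambda>i. u (Suc i)" "\<lambda>i. w (Suc i)" j] Suc.prems by simp
  with 0 show ?case using Suc.prems by (cases i) auto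
qed

lemma digits_less:
  fixes u :: "nat \<Rightarrow> nat"
  assumes "\<And>i. i < D \<Longrightarrow> u i < B"
  shows "(\<Sum>i<D. u i * B ^ i) < B ^ D"
  using assms
proof (induction D)
  case (Suc D)
  have "(\<Sum>i<Suc D. u i * B ^ i) < B ^ D + u D * B ^ D"
    using Suc by simp
  also have "\<dots> = Suc (u D) * B ^ D" by simp
  also have "\<dots> \<le> B * B ^ D"
    using Suc.prems[of D] by (intro mult_right_mono) auto
  finally show ?case by simp
qed simp

text \<open>
  The proof rests on \<open>(a + b) (a x\<^sup>2 + b y\<^sup>2) - (a x + b y)\<^sup>2 = a b (x - y)\<^sup>2\<close>.
\<close>

lemma sphere_strictly_convex:
  fixes x y z :: "nat \<Rightarrow> nat" and a b :: nat
  assumes "0 < a" "0 < b" "finite I"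
    and lin: "\<And>i. i \<in> I \<Longrightarrow> a * x i + b * y i = (a + b) * z i"
    and "(\<Sum>i\<in>I. (x i)\<^sup>2) = R" "(\<Sum>i\<in>I. (y i)\<^sup>2) = R" "(\<Sum>i\<in>I. (z i)\<^sup>2) = R"
    and "i \<in> I"
  shows "x i = y i"
proof -
  have R: "(\<Sum>i\<in>I. (int (x i))\<^sup>2) = int R" "(\<Sum>i\<in>I. (int (y i))\<^sup>2) = int R"
    "(\<Sum>i\<in>I. (int (z i))\<^sup>2) = int R"
    using assms(5-7)[THEN arg_cong[of _ _ int]] by simp_all
  have pt: "int a * int b * (int (x i) - int (y i))\<^sup>2 =
      (int a + int b) * (int a * (int (x i))\<^sup>2 + int b * (int (y i))\<^sup>2 - (int a + int b) * (int (z i))\<^sup>2)"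
    if "i \<in> I" for i
  proof -
    have l: "int a * int (x i) + int b * int (y i) = (int a + int b) * int (z i)"
      using lin[OF that] by (metis of_nat_add of_nat_mult)
    have "int a * int b * (int (x i) - int (y i))\<^sup>2 =
      (int a + int b) * (int a * (int (x i))\<^sup>2 + int b * (int (y i))\<^sup>2) -
      (int a * int (x i) + int b * int (y i))\<^sup>2"
      by (simp add: power2_eq_square algebra_simps)
    also have "\<dots> = (int a + int b) * (int a * (int (x i))\<^sup>2 + int b * (int (y i))\<^sup>2) -
      ((int a + int b) * int (z i))\<^sup>2" by (simp only: l)
    finally show ?thesis by (simp add: power2_eq_square algebra_simps)
  qed
  have "(\<Sum>i\<in>I. int a * int b * (int (x i) - int (y i))\<^sup>2) = (\<Sum>i\<in>I. (int a + int b) *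
      (int a * (int (x i))\<^sup>2 + int b * (int (y i))\<^sup>2 - (int a + int b) * (int (z i))\<^sup>2))"
    by (intro sum.cong refl pt)
  also have "\<dots> = (int a + int b) * (int a * (\<Sum>i\<in>I. (int (x i))\<^sup>2) +
      int b * (\<Sum>i\<in>I. (int (y i))\<^sup>2) - (int a + int b) * (\<Sum>i\<in>I. (int (z i))\<^sup>2))"
    by (simp only: sum_distrib_left[symmetric] sum.distrib sum_subtractf)
  also have "\<dots> = 0" by (simp only: R) (simp add: algebra_simps)
  finally have "int a * int b * (int (x i) - int (y i))\<^sup>2 = 0"
    using sum_nonneg_eq_0_iff[OF \<open>finite I\<close>, of "\<lambda>i. int a * int b * (int (x i) - int (y i))\<^sup>2"]
      \<open>i \<in> I\<close> by auto
  then show ?thesis using assms(1,2) by simp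
qed

text \<open>The case \<open>a = b = 1\<close> excludes proper three-term progressions. General
  weights arise as gaps between part numbers, hence the bound \<open>k\<close> on their sum.\<close>

definition convex_free :: "nat \<Rightarrow> nat set \<Rightarrow> bool" where
  "convex_free k S \<longleftrightarrow> (\<forall>a b. \<forall>x\<in>S. \<forall>y\<in>S. \<forall>z\<in>S.
     0 < a \<longrightarrow> 0 < b \<longrightarrow> a + b \<le> k \<longrightarrow> a * x + b * y = (a + b) * z \<longrightarrow> x = y)"

text \<open>
  The digits stay below \<open>2 ^ D\<close> in base \<open>k * 2 ^ D\<close>, so that the linear relation produces no
  carries and holds digit by digit.
\<close>

lemma behrend:
  fixes k D :: nat
  assumes "0 < k" "0 < D"
  defines "L \<equiv> (k * 2 ^ D) ^ D"
  shows "\<exists>S \<subseteq> {..<L}. convex_free k S \<and> L \<le> card S * (8 * k) ^ D"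
proof -
  define r :: nat where "r = 2 ^ D"
  define B where "B = k * r"
  have rB: "r \<le> B" using assms by (simp add: B_def)
  define X where "X = {..<D} \<rightarrow>\<^sub>E {..<r}"
  define q where "q x = (\<Sum>i<D. (x i)\<^sup>2)" for x :: "nat \<Rightarrow> nat"
  define num where "num x = (\<Sum>i<D. x i * B ^ i)" for x :: "nat \<Rightarrow> nat"
  have finX: "finite X" by (simp add: X_def finite_PiE)
  have cardX: "card X = r ^ D" by (simp add: X_def card_PiE)
  have XD: "x i < r" if "x \<in> X" "i < D" for x i using that by (auto simp: X_def PiE_def Pi_def)
  have inj: "inj_on num X"
  proof (rule inj_onI)
    fix x y assume xy: "x \<in> X" "y \<in> X" "num x = num y"
    have "x i = y i" if "i < D" for i
      using digits_unique[of x B D y i] xy(3) XD[OF xy(1)] XD[OF xy(2)] rB that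
      unfolding num_def by (meson order_less_le_trans)
    with xy(1,2) show "x = y" unfolding X_def by (intro PiE_ext) auto
  qed
  have qlt: "q x < D * r\<^sup>2" if "x \<in> X" for x
  proof -
    have "q x < (\<Sum>i<D. r\<^sup>2)"
      unfolding q_def using XD[OF that] assms(2)
      by (intro sum_strict_mono) (auto intro!: power_strict_mono)
    then show ?thesis by simp
  qed
  \<comment> \<open>Pigeonhole: the squared norm takes at most \<open>D * r\<^sup>2\<close> values,
    so some sphere holds at least the average number of points.\<close>
  have "\<exists>R. card X \<le> card {x \<in> X. q x = R} * (D * r\<^sup>2)"
  proof (rule ccontr)
    assume no: "\<not> ?thesis"
    have "(\<Sum>R<D * r\<^sup>2. card {x \<in> X. q x = R}) = card X"
      using sum.group[OF finX, of "{..<D * r\<^sup>2}" q "\<lambda>_. 1::nat"] qlt by auto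
    then have "card X * (D * r\<^sup>2) = (\<Sum>R<D * r\<^sup>2. card {x \<in> X. q x = R}) * (D * r\<^sup>2)"
      by simp
    also have "\<dots> < (\<Sum>R<D * r\<^sup>2. card X)"
      unfolding sum_distrib_right using no assms(2)
      by (intro sum_strict_mono) (auto simp: r_def not_le lessThan_empty_iff)
    finally show False by simp
  qed
  then obtain R where R: "card X \<le> card {x \<in> X. q x = R} * (D * r\<^sup>2)" by blast
  define S where "S = num ` {x \<in> X. q x = R}"
  have LB: "L = B ^ D" by (simp add: L_def B_def r_def)
  have "S \<subseteq> {..<L}"
  proof -
    have "num x < L" if "x \<in> X" for x
      unfolding num_def LB using XD[OF that] rB by (intro digits_less) (meson order_less_le_trans)
    then show ?thesis by (auto simp: S_def)
  qed
  moreover have "convex_free k S"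
    unfolding convex_free_def S_def
  proof (intro allI ballI impI)
    fix a b s t w
    assume ab: "0 < a" "0 < b" "a + b \<le> k" and lin: "a * s + b * t = (a + b) * w"
      and "s \<in> num ` {x \<in> X. q x = R}" "t \<in> num ` {x \<in> X. q x = R}" "w \<in> num ` {x \<in> X. q x = R}"
    then obtain x y z where mem: "x \<in> X" "y \<in> X" "z \<in> X" and qs: "q x = R" "q y = R" "q z = R"
      and st: "s = num x" "t = num y" "w = num z" by auto
    have small: "a * u + b * v < B" if "u < r" "v < r" for u v
    proof -
      have "a * u + b * v < a * r + b * r"
        using that ab by (intro add_strict_mono mult_strict_left_mono) auto
      also have "\<dots> = (a + b) * r" by (simp add: algebra_simps)
      also have "\<dots> \<le> B" using ab unfolding B_def by (intro mult_right_mono) auto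
      finally show ?thesis .
    qed
    \<comment> \<open>Splitting \<open>(a + b) * z i\<close> lets the bound \<open>small\<close>
      serve for the digits of both sides.\<close>
    have "(\<Sum>i<D. (a * x i + b * y i) * B ^ i) = (\<Sum>i<D. (a * z i + b * z i) * B ^ i)"
      using lin unfolding st num_def
      by (simp add: sum_distrib_left sum.distrib algebra_simps)
    then have "a * x i + b * y i = a * z i + b * z i" if "i < D" for i
      by (rule digits_unique) (use small XD mem that in auto)
    then have "x i = y i" if "i < D" for i
      using sphere_strictly_convex[of a b "{..<D}" x y z R i] ab qs that
      by (simp add: q_def algebra_simps)
    then show "s = t" by (simp add: st num_def)
  qed
  moreover have "L \<le> card S * (8 * k) ^ D"
  proof -
    have "card S = card {x \<in> X. q x = R}"
      unfolding S_def by (rule card_image) (rule inj_on_subset[OF inj], auto)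
    with R cardX have c: "r ^ D \<le> card S * (D * r\<^sup>2)" by simp
    \<comment> \<open>In the loss \<open>(8 * k) ^ D\<close>, the factor \<open>8 ^ D\<close> bounds
      the number of spheres and \<open>k ^ D\<close> is the price of the larger base
      \<open>B = k * r\<close>.\<close>
    have "D * r\<^sup>2 \<le> 2 ^ D * r\<^sup>2" by (intro mult_right_mono) (auto intro: less_imp_le)
    also have "\<dots> = 8 ^ D"
      unfolding r_def by (simp add: power_mult[symmetric] power2_eq_square power_mult_distrib[symmetric])
    finally have c8: "r ^ D \<le> card S * 8 ^ D"
      using c by (meson le_trans mult_le_mono2)
    have "L = k ^ D * r ^ D" by (simp add: LB B_def power_mult_distrib)
    also have "\<dots> \<le> k ^ D * (card S * 8 ^ D)" using c8 by simp
    finally show ?thesis by (simp add: power_mult_distrib mult_ac)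
  qed
  ultimately show ?thesis by blast
qed

subsection \<open>Chains of successive pairs\<close>

text \<open>Successive pairs may share an end point. The slack \<open>u \<le> x\<close> makes the
  relation monotone in both end points.\<close>

inductive chain :: "(nat \<Rightarrow> nat \<Rightarrow> bool) \<Rightarrow> nat \<Rightarrow> nat \<Rightarrow> nat \<Rightarrow> bool" for E where
  chain_0: "u \<le> v \<Longrightarrow> chain E 0 u v"
| chain_Suc: "u \<le> x \<Longrightarrow> x < y \<Longrightarrow> E x y \<Longrightarrow> chain E s y v \<Longrightarrow> chain E (Suc s) u v"

lemma chain_length: "chain E s u v \<Longrightarrow> u + s \<le> v"
  by (induction rule: chain.induct) auto

lemma chain_mono_left: "chain E s u v \<Longrightarrow> u' \<le> u \<Longrightarrow> chain E s u' v"
  by (induction rule: chain.induct) (auto intro: chain.intros dest: le_trans)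

lemma chain_mono_right: "chain E s u v \<Longrightarrow> v \<le> v' \<Longrightarrow> chain E s u v'"
  by (induction rule: chain.induct) (auto intro: chain.intros dest: le_trans)

lemma chain_append: "chain E s u v \<Longrightarrow> chain E s' v w \<Longrightarrow> chain E (s + s') u w"
  by (induction rule: chain.induct) (auto intro: chain.intros chain_mono_left)

lemma chain_edge: "x < y \<Longrightarrow> E x y \<Longrightarrow> chain E 1 x y"
  using chain_Suc[of x x y E 0 y] chain_0[of y y] by simp

lemma chain_split:
  "chain E (s + s') u w \<Longrightarrow> \<exists>v. chain E s u v \<and> chain E s' v w"
proof (induction s arbitrary: u)
  case 0
  then show ?case by (auto intro: chain_0)
next
  case (Suc s)
  from Suc.prems obtain x y where "u \<le> x" "x < y" "E x y" "chain E (s + s') y w"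
    by (cases rule: chain.cases) auto
  with Suc.IH show ?case by (blast intro: chain_Suc)
qed

text \<open>Knaster--Tarski on a finite chain: the largest \<open>i\<close> with \<open>i \<le> f i\<close> is fixed.\<close>

lemma finite_mono_fixpoint:
  fixes f :: "'a::linorder \<Rightarrow> 'a"
  assumes "finite C" "C \<noteq> {}" "f ` C \<subseteq> C"
    and mono: "\<And>i j. i \<in> C \<Longrightarrow> j \<in> C \<Longrightarrow> i \<le> j \<Longrightarrow> f i \<le> f j"
  shows "\<exists>i\<in>C. f i = i"
proof -
  define P where "P = {i \<in> C. i \<le> f i}"
  have "Min C \<in> C" using assms by simp
  then have "Min C \<in> P"
    using assms(1,3) by (auto simp: P_def image_subset_iff)
  moreover have fin: "finite P" using assms by (simp add: P_def)
  ultimately have M: "Max P \<in> P" by (intro Max_in) auto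
  then have "f (Max P) \<in> P"
    using assms by (auto simp: P_def)
  then have "f (Max P) \<le> Max P" using fin by simp
  moreover have "Max P \<in> C" "Max P \<le> f (Max P)" using M unfolding P_def by blast+
  ultimately show ?thesis by (intro bexI[of _ "Max P"] antisym)
qed

section \<open>Levels and core vertices\<close>

locale pattern =
  fixes k :: nat and E :: "nat \<Rightarrow> nat \<Rightarrow> bool"
  assumes two_edges: "chain E 2 0 (k - 1)"
begin

definition before :: "nat \<Rightarrow> nat" where
  "before v = Max {s. chain E s 0 v}"

definition after :: "nat \<Rightarrow> nat" where
  "after v = Max {s. chain E s v (k - 1)}"

definition top_level :: nat where
  "top_level = before (k - 1)"

text \<open>The sum never exceeds \<open>top_level\<close>, so equality says that a longest chain
  can be cut at \<open>v\<close>; the level of \<open>v\<close> is then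
  \<open>before v\<close>.\<close>

definition core :: "nat set" where
  "core = {v. v < k \<and> before v + after v = top_level}"

lemma k_pos: "0 < k"
  using chain_length[OF two_edges] by simp

lemma finite_chains: "finite {s. chain E s u v}"
  by (rule finite_subset[of _ "{..v}"]) (auto dest: chain_length)

lemma chain_before: "chain E (before v) 0 v"
  using Max_in[OF finite_chains, of 0 v] chain_0[of 0 v E] unfolding before_def by blast

lemma before_ge: "chain E s 0 v \<Longrightarrow> s \<le> before v"
  unfolding before_def by (rule Max_ge[OF finite_chains]) simp

lemma chain_after: "v < k \<Longrightarrow> chain E (after v) v (k - 1)"
  using Max_in[OF finite_chains, of v "k - 1"] chain_0[of v "k - 1" E]
  unfolding after_def by fastforce

lemma after_ge: "chain E s v (k - 1) \<Longrightarrow> s \<le> after v"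
  unfolding after_def by (rule Max_ge[OF finite_chains]) simp

lemma top_level_ge_2: "2 \<le> top_level"
  unfolding top_level_def using two_edges by (rule before_ge)

lemma before_mono: "u \<le> v \<Longrightarrow> before u \<le> before v"
  using chain_mono_right[OF chain_before] by (rule before_ge)

lemma after_antimono: "u \<le> v \<Longrightarrow> v < k \<Longrightarrow> after v \<le> after u"
  using chain_mono_left[OF chain_after] by (intro after_ge) auto

lemma before_edge: "x < y \<Longrightarrow> E x y \<Longrightarrow> before x < before y"
  using before_ge[OF chain_append[OF chain_before chain_edge]] by fastforce

lemma after_edge: "x < y \<Longrightarrow> y < k \<Longrightarrow> E x y \<Longrightarrow> after y < after x"
  using after_ge[OF chain_append[OF chain_edge chain_after]] by fastforce

lemma before_after_le: "v < k \<Longrightarrow> before v + after v \<le> top_level"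
  unfolding top_level_def by (intro before_ge chain_append[OF chain_before chain_after])

lemma coreI: "v < k \<Longrightarrow> top_level \<le> before v + after v \<Longrightarrow> v \<in> core"
  using before_after_le[of v] by (simp add: core_def)

text \<open>A longest chain is cut after its first \<open>s\<close> pairs. The cut point has at
  least \<open>s\<close> pairs before it and \<open>top_level - s\<close> after it, and maximality
  makes both bounds sharp.\<close>

lemma core_level_nonempty:
  assumes "s \<le> top_level"
  shows "\<exists>v\<in>core. before v = s"
proof -
  have "chain E (s + (top_level - s)) 0 (k - 1)"
    using chain_before[of "k - 1"] assms by (simp add: top_level_def)
  then obtain v where v: "chain E s 0 v" "chain E (top_level - s) v (k - 1)"
    using chain_split by blast
  with chain_length[OF v(2)] k_pos have "v < k" by linarith
  with before_ge[OF v(1)] after_ge[OF v(2)] before_after_le[of v] assms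
  show ?thesis by (intro bexI[of _ v] coreI) auto
qed

text \<open>The pair \<open>x y\<close> opens a longest chain from \<open>v\<close>. A longer rest
  from \<open>y\<close> would, with this pair in front, exceed \<open>after v\<close>.\<close>

lemma after_SucE:
  assumes "v < k" "after v = Suc s"
  obtains x y where "v \<le> x" "x < y" "y < k" "E x y" "after y = s"
proof -
  from chain_after[OF assms(1)] assms(2)
  obtain x y where xy: "v \<le> x" "x < y" "E x y" "chain E s y (k - 1)"
    by (auto elim: chain.cases)
  have "y < k" using chain_length[OF xy(4)] k_pos by linarith
  moreover have "after y = s"
    using after_ge[OF xy(4)] after_edge[of x y] after_antimono[of v x] xy \<open>y < k\<close> assms
    by linarith
  ultimately show ?thesis using that xy by blast
qed

text \<open>
  Here \<open>\<phi>\<close> records the parts in which the vertices of a copy lie. The map raises \<open>before\<close> along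
  chains, so on core vertices it can neither raise nor lower it; that the images are core vertices
  again follows by downward induction on the level.
\<close>

lemma core_invariant:
  fixes \<phi> :: "nat \<Rightarrow> nat"
  assumes range: "\<And>i. i < k \<Longrightarrow> \<phi> i < k"
    and mono: "\<And>i j. i \<le> j \<Longrightarrow> j < k \<Longrightarrow> \<phi> i \<le> \<phi> j"
    and incr: "\<And>i j. i < j \<Longrightarrow> j < k \<Longrightarrow> E i j \<Longrightarrow> before (\<phi> i) < before (\<phi> j)"
    and unif: "\<And>i j. i < j \<Longrightarrow> j < k \<Longrightarrow> E i j \<Longrightarrow> \<phi> i \<in> core \<or> \<phi> j \<notin> core \<or>
                 \<phi> i < \<phi> j \<and> E (\<phi> i) (\<phi> j)"
    and "v \<in> core"
  shows "\<phi> v \<in> core \<and> before (\<phi> v) = before v"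
proof -
  \<comment> \<open>Each pair of the chain raises \<open>before\<close> of the image by at least
    one, and the gaps between pairs never lower it.\<close>
  have climb: "before (\<phi> u) + s \<le> before (\<phi> w)" if "chain E s u w" "w < k" for s u w
    using that
  proof (induction rule: chain.induct)
    case (chain_0 u v)
    then show ?case using before_mono[OF mono] by simp
  next
    case (chain_Suc u x y s v)
    have "y < k" using chain_length[OF chain_Suc.hyps(4)] chain_Suc.prems by simp
    with incr[of x y] before_mono[OF mono[of u x]] chain_Suc show ?case by force
  qed
  have level: "before (\<phi> v) = before v" if "v \<in> core" for v
  proof (rule antisym)
    have v: "v < k" "before v + after v = top_level" using that by (auto simp: core_def)
    show "before v \<le> before (\<phi> v)"
      using climb[OF chain_before v(1)] by simp
    \<comment> \<open>Were the image of \<open>v\<close> too high, the \<open>after v\<close> pairs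
      still to be climbed would lead beyond \<open>top_level\<close>.\<close>
    have "before (\<phi> v) + after v \<le> before (\<phi> (k - 1))"
      using climb[OF chain_after[OF v(1)]] k_pos by simp
    also have "\<dots> \<le> top_level"
      unfolding top_level_def using range[of "k - 1"] k_pos by (intro before_mono) linarith
    finally show "before (\<phi> v) \<le> before v" using v by simp
  qed
  have "\<phi> v \<in> core" if "v \<in> core" "after v = s" for s
    using that
  proof (induction s arbitrary: v)
    \<comment> \<open>At the top level the value of \<open>before\<close> alone certifies membership
      in the core.\<close>
    case 0
    then show ?case
      using level[of v] range[of v] by (intro coreI) (auto simp: core_def)
  next
    case (Suc s)
    have v: "v < k" "before v + Suc s = top_level" using Suc.prems by (auto simp: core_def)
    \<comment> \<open>The first pair of a longest chain after \<open>v\<close> ends in a core vertex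
      \<open>y\<close> one level higher, where the induction hypothesis applies.\<close>
    obtain x y where xy: "v \<le> x" "x < y" "y < k" "E x y" "after y = s"
      using after_SucE[OF v(1) Suc.prems(2)] by blast
    have "y \<in> core"
      using before_mono[OF xy(1)] before_edge[OF xy(2,4)] xy v by (intro coreI) auto
    then have y: "\<phi> y \<in> core" "before (\<phi> y) = before y" using Suc.IH level xy by auto
    have ay: "after (\<phi> y) = s"
      using y \<open>y \<in> core\<close> xy by (auto simp: core_def)
    have "x < k" using xy by simp
    have bx: "before v = before x"
      using before_mono[OF xy(1)] before_edge[OF xy(2,4)] \<open>y \<in> core\<close> xy(5) v
      by (auto simp: core_def)
    have "x \<in> core"
      using after_edge[OF xy(2,3,4)] xy(5) v bx \<open>x < k\<close> by (intro coreI) auto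
    \<comment> \<open>If \<open>\<phi> x\<close> lies outside the core, \<open>unif\<close> yields a
      pattern pair from \<open>\<phi> x\<close> to \<open>\<phi> y\<close>, which extends a longest
      chain from \<open>\<phi> y\<close> by one.\<close>
    have "Suc s \<le> after (\<phi> x)"
    proof (cases "\<phi> x \<in> core")
      case True
      then show ?thesis using level[OF \<open>x \<in> core\<close>] bx v by (auto simp: core_def)
    next
      case False
      with unif[OF xy(2,3,4)] y have "\<phi> x < \<phi> y" "E (\<phi> x) (\<phi> y)" by auto
      from after_edge[OF this(1) range[OF xy(3)] this(2)] ay show ?thesis by simp
    qed
    also have "\<dots> \<le> after (\<phi> v)"
      using mono[OF xy(1) \<open>x < k\<close>] range[OF \<open>x < k\<close>] by (rule after_antimono)
    finally show ?case
      using level[OF Suc.prems(1)] v range[OF v(1)] by (intro coreI) auto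
  qed
  with level[OF \<open>v \<in> core\<close>] \<open>v \<in> core\<close> show ?thesis by blast
qed

subsection \<open>The host graph\<close>

definition behrend_pair :: "nat set \<Rightarrow> nat \<Rightarrow> nat \<Rightarrow> nat \<Rightarrow> nat \<Rightarrow> bool" where
  "behrend_pair S p q r r' \<longleftrightarrow> (\<exists>x. \<exists>d\<in>S. r = x + p * d \<and> r' = x + q * d)"

text \<open>
  Adjacency of a vertex at position \<open>r\<close> of part \<open>p\<close> and a vertex at position \<open>r'\<close>
  of part \<open>q\<close>.
\<close>

definition host_adj :: "nat set \<Rightarrow> nat \<Rightarrow> nat \<Rightarrow> nat \<Rightarrow> nat \<Rightarrow> bool" where
  "host_adj S p q r r' \<longleftrightarrow> p < q \<and>
     (if p \<in> core \<and> q \<in> core \<and> before p < before q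
      then E p q \<longleftrightarrow> behrend_pair S p q r r' else E p q)"

lemma host_adj_behrend_pair: "p < q \<Longrightarrow> behrend_pair S p q r r' \<Longrightarrow> host_adj S p q r r' \<longleftrightarrow> E p q"
  by (auto simp: host_adj_def)

text \<open>With gaps \<open>a = j - i\<close> and \<open>b = l - j\<close>, the direct way from
  \<open>i\<close> to \<open>l\<close> and the way through \<open>j\<close> give
  \<open>a * d1 + b * d2 = (a + b) * d3\<close>, so the differences agree. The conclusion is
  collinearity of the positions, free of subtraction of positions; any two of them determine the
  third.\<close>

lemma behrend_triangle:
  assumes S: "convex_free k S" and ord: "i < j" "j < l" "l < k"
    and ij: "behrend_pair S i j r r'" and jl: "behrend_pair S j l r' r''"
    and il: "behrend_pair S i l r r''"
  shows "(j - i) * r'' + (l - j) * r = (l - i) * r'"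
proof -
  obtain a where a: "j = i + a" "0 < a" using ord by (metis less_imp_add_positive)
  obtain b where b: "l = i + a + b" "0 < b" using ord a by (metis less_imp_add_positive)
  obtain x1 d1 where 1: "d1 \<in> S" "r = x1 + i * d1" "r' = x1 + j * d1"
    using ij by (auto simp: behrend_pair_def)
  obtain x2 d2 where 2: "d2 \<in> S" "r' = x2 + j * d2" "r'' = x2 + l * d2"
    using jl by (auto simp: behrend_pair_def)
  obtain x3 d3 where 3: "d3 \<in> S" "r = x3 + i * d3" "r'' = x3 + l * d3"
    using il by (auto simp: behrend_pair_def)
  have e1: "r' = r + a * d1" using 1 a by (simp add: algebra_simps)
  have e2: "r'' = r' + b * d2" using 2 a b by (simp add: algebra_simps)
  have e3: "r'' = r + (a + b) * d3" using 3 a b by (simp add: algebra_simps)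
  have "a * d1 + b * d2 = (a + b) * d3" using e1 e2 e3 by simp
  moreover have "a + b \<le> k" using a b ord by simp
  ultimately have "d1 = d2"
    using S 1(1) 2(1) 3(1) a b unfolding convex_free_def by blast
  then show ?thesis using e1 e2 a b by (simp add: algebra_simps)
qed

text \<open>Here \<open>\<phi> i\<close> and \<open>\<rho> i\<close> are the part and the position
  of the vertex number \<open>i\<close> of a copy.\<close>

lemma copy_contains_behrend_triangle:
  fixes \<phi> \<rho> :: "nat \<Rightarrow> nat"
  assumes S: "convex_free k S"
    and range: "\<And>i. i < k \<Longrightarrow> \<phi> i < k"
    and mono: "\<And>i j. i \<le> j \<Longrightarrow> j < k \<Longrightarrow> \<phi> i \<le> \<phi> j"
    and copy: "\<And>i j. i < j \<Longrightarrow> j < k \<Longrightarrow> E i j \<longleftrightarrow> host_adj S (\<phi> i) (\<phi> j) (\<rho> i) (\<rho> j)"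
  shows "\<exists>i j l. i < j \<and> j < l \<and> l < k \<and> (j - i) * \<rho> l + (l - j) * \<rho> i = (l - i) * \<rho> j"
proof -
  define C where "C s = {v \<in> core. before v = s}" for s
  have "\<exists>v\<in>C s. \<phi> v = v" if "s \<le> top_level" for s
  proof (rule finite_mono_fixpoint)
    show "finite (C s)" by (simp add: C_def core_def)
    show "C s \<noteq> {}" using core_level_nonempty[OF that] by (auto simp: C_def)
    have "\<phi> v \<in> core \<and> before (\<phi> v) = before v" if "v \<in> core" for v
    proof (rule core_invariant[OF range mono])
      fix i j assume "i < j" "j < k" "E i j"
      then have h: "host_adj S (\<phi> i) (\<phi> j) (\<rho> i) (\<rho> j)" using copy by blast
      \<comment> \<open>A pattern pair of the host either comes from a pattern pair of
        \<open>E\<close>, where \<open>before_edge\<close> applies, or joins core vertices of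
        increasing level.\<close>
      then show "before (\<phi> i) < before (\<phi> j)"
        unfolding host_adj_def using before_edge by (metis (full_types))
      then show "\<phi> i \<in> core \<or> \<phi> j \<notin> core \<or> \<phi> i < \<phi> j \<and> E (\<phi> i) (\<phi> j)"
        using h unfolding host_adj_def by presburger
    qed (use that in auto)
    then show "\<phi> ` C s \<subseteq> C s" by (auto simp: C_def)
    show "\<phi> i \<le> \<phi> j" if "i \<in> C s" "j \<in> C s" "i \<le> j" for i j
      using that by (intro mono) (auto simp: C_def core_def)
  qed
  then have "\<exists>v. v \<in> C s \<and> \<phi> v = v" if "s \<le> 2" for s
    using order_trans[OF that top_level_ge_2] by blast
  then obtain i j l where fix_i: "i \<in> C 0" "\<phi> i = i" and fix_j: "j \<in> C 1" "\<phi> j = j"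
    and fix_l: "l \<in> C 2" "\<phi> l = l"
    by (metis one_le_numeral order_refl zero_le)
  have ord: "p < q" if "p \<in> C s" "q \<in> C t" "s < t" for p q s t
    using that before_mono[of q p] unfolding C_def by (auto simp: not_le[symmetric])
  \<comment> \<open>At fixed points \<open>copy\<close> reads \<open>E p q \<longleftrightarrow> (E
    p q \<longleftrightarrow> behrend_pair S p q _ _)\<close>, which forces a Behrend pair whether
    or not \<open>E p q\<close> holds.\<close>
  have pair: "behrend_pair S p q (\<rho> p) (\<rho> q)"
    if "p \<in> C s" "q \<in> C t" "s < t" "\<phi> p = p" "\<phi> q = q" for p q s t
    using copy[of p q] ord[OF that(1-3)] that by (auto simp: host_adj_def C_def core_def)
  have "i < j" "j < l" "l < k" using ord fix_i fix_j fix_l by (auto simp: C_def core_def)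
  then show ?thesis
    using behrend_triangle[OF S] pair fix_i fix_j fix_l
    by (meson less_one one_less_numeral_iff semiring_norm(76) zero_less_numeral)
qed

end

subsection \<open>Counting copies and pair-disjoint copies\<close>

lemma card_mod_fibre_le:
  fixes n N r :: nat
  shows "card {b. b < n \<and> b mod N = r} \<le> n div N + 1"
proof -
  have "inj_on (\<lambda>b. b div N) {b. b < n \<and> b mod N = r}"
  proof (rule inj_onI, clarsimp)
    fix b b' assume "b div N = b' div N" "b' mod N = b mod N"
    then show "b = b'" using div_mult_mod_eq[of b N] div_mult_mod_eq[of b' N] by simp
  qed
  moreover have "(\<lambda>b. b div N) ` {b. b < n \<and> b mod N = r} \<subseteq> {..n div N}"
    by (auto intro: div_le_mono)
  ultimately show ?thesis by (metis card_inj_on_le card_atMost finite_atMost Suc_eq_plus1)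
qed

text \<open>Once the values away from \<open>z\<close> are fixed, at most \<open>M\<close> values
  remain at \<open>z\<close>. Passing the restriction to \<open>P\<close> keeps that first choice
  independent of \<open>f z\<close>.\<close>

lemma card_PiE_fibre_le:
  assumes "finite A" "z \<in> A" "finite B"
    and "\<And>f. f \<in> A - {z} \<rightarrow>\<^sub>E B \<Longrightarrow> card {b \<in> B. P f b} \<le> M"
  shows "card {f \<in> A \<rightarrow>\<^sub>E B. P (restrict f (A - {z})) (f z)} \<le> card B ^ (card A - 1) * M"
proof -
  let ?split = "\<lambda>f. (restrict f (A - {z}), f z)"
  let ?T = "SIGMA f:A - {z} \<rightarrow>\<^sub>E B. {b \<in> B. P f b}"
  have finT: "finite ?T" using assms by (intro finite_SigmaI finite_PiE) auto
  have "inj_on ?split (A \<rightarrow>\<^sub>E B)"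
  proof (rule inj_onI)
    fix f f' assume f: "f \<in> A \<rightarrow>\<^sub>E B" "f' \<in> A \<rightarrow>\<^sub>E B" and eq: "?split f = ?split f'"
    have "f x = f' x" if "x \<in> A" for x
      using eq that by (cases "x = z") (auto simp: restrict_def fun_eq_iff split: if_splits)
    with f show "f = f'" by (intro PiE_ext) auto
  qed
  then have "inj_on ?split {f \<in> A \<rightarrow>\<^sub>E B. P (restrict f (A - {z})) (f z)}"
    by (rule inj_on_subset) auto
  moreover have "?split ` {f \<in> A \<rightarrow>\<^sub>E B. P (restrict f (A - {z})) (f z)} \<subseteq> ?T"
    using \<open>z \<in> A\<close> by (auto simp: PiE_def Pi_def)
  ultimately have "card {f \<in> A \<rightarrow>\<^sub>E B. P (restrict f (A - {z})) (f z)} \<le> card ?T"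
    using finT by (rule card_inj_on_le)
  also have "\<dots> = (\<Sum>f\<in>A - {z} \<rightarrow>\<^sub>E B. card {b \<in> B. P f b})"
    using assms by (intro card_SigmaI finite_PiE) auto
  also have "\<dots> \<le> card (A - {z} \<rightarrow>\<^sub>E B) * M"
    using sum_bounded_above[of "A - {z} \<rightarrow>\<^sub>E B" "\<lambda>f. card {b \<in> B. P f b}" M] assms(4) by simp
  also have "card (A - {z} \<rightarrow>\<^sub>E B) = card B ^ (card A - 1)"
    using assms by (simp add: card_PiE)
  finally show ?thesis .
qed

text \<open>As \<open>0 < a\<close>, the values at \<open>x\<close> and \<open>y\<close> leave at
  most one residue for \<open>f z\<close>, so one factor \<open>n\<close> shrinks to the size of a
  residue class.\<close>

lemma card_linear_relation_le:
  fixes N n a b c :: nat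
  assumes "finite V" "x \<in> V" "y \<in> V" "z \<in> V" "z \<noteq> x" "z \<noteq> y" "0 < a"
  shows "card {f \<in> V \<rightarrow>\<^sub>E {..<n}. a * (f z mod N) + b * (f x mod N) = c * (f y mod N)}
    \<le> n ^ (card V - 1) * (n div N + 1)"
proof -
  define P where "P f v \<longleftrightarrow> a * (v mod N) + b * (f x mod N) = c * (f y mod N)"
    for f :: "'a \<Rightarrow> nat" and v
  have "card {v \<in> {..<n}. P f v} \<le> n div N + 1" for f
  proof (cases "\<exists>w. P f w")
    case True
    then obtain w where w: "P f w" by blast
    have "{v \<in> {..<n}. P f v} \<subseteq> {v. v < n \<and> v mod N = w mod N}"
    proof clarsimp
      fix v assume "P f v"
      with w have "a * (v mod N) = a * (w mod N)" unfolding P_def by linarith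
      with \<open>0 < a\<close> show "v mod N = w mod N" by simp
    qed
    then have "card {v \<in> {..<n}. P f v} \<le> card {v. v < n \<and> v mod N = w mod N}"
      by (intro card_mono) auto
    with card_mod_fibre_le[of n N "w mod N"] show ?thesis by linarith
  qed simp
  then have "card {f \<in> V \<rightarrow>\<^sub>E {..<n}. P (restrict f (V - {z})) (f z)}
      \<le> card {..<n} ^ (card V - 1) * (n div N + 1)"
    using assms by (intro card_PiE_fibre_le) auto
  then show ?thesis using assms by (simp add: P_def)
qed

section \<open>Graphs on initial segments and increasing enumerations\<close>

definition pair_graph :: "nat \<Rightarrow> (nat \<Rightarrow> nat \<Rightarrow> bool) \<Rightarrow> nat ordered_graph" where
  "pair_graph n col = \<lparr>verts = {..<n}, edges = {{u, v} | u v. u < v \<and> v < n \<and> col u v},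
     vorder = {(u, v). u \<le> v \<and> v < n}\<rparr>"

lemma verts_pair_graph [simp]: "verts (pair_graph n col) = {..<n}"
  and vorder_pair_graph [simp]: "vorder (pair_graph n col) = {(u, v). u \<le> v \<and> v < n}"
  by (simp_all add: pair_graph_def)

lemma edge_pair_graph_iff: "u < v \<Longrightarrow> v < n \<Longrightarrow> {u, v} \<in> edges (pair_graph n col) \<longleftrightarrow> col u v"
  by (auto simp: pair_graph_def doubleton_eq_iff)

lemma is_ordered_graph_pair_graph: "is_ordered_graph (pair_graph n col)"
proof -
  have "linear_order_on {..<n} {(u, v). u \<le> v \<and> v < n}"
    unfolding order_on_defs refl_on_def trans_def antisym_def total_on_def by (safe; simp)
  moreover have "edges (pair_graph n col) \<subseteq> all_pairs {..<n}"
    unfolding pair_graph_def all_pairs_def by fastforce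
  ultimately show ?thesis by (simp add: is_ordered_graph_def)
qed

definition order_enum :: "'a ordered_graph \<Rightarrow> (nat \<Rightarrow> 'a) \<Rightarrow> bool" where
  "order_enum F g \<longleftrightarrow> bij_betw g {..<card (verts F)} (verts F) \<and>
     (\<forall>i<card (verts F). \<forall>j<card (verts F). (g i, g j) \<in> vorder F \<longleftrightarrow> i \<le> j)"

text \<open>The number of strict predecessors is a strictly increasing rank with values below the
  number of vertices; its inverse is the enumeration.\<close>

lemma order_enum_exists:
  assumes "is_ordered_graph F"
  shows "\<exists>g. order_enum F g"
proof -
  let ?V = "verts F" and ?R = "vorder F"
  have fin: "finite ?V" and R: "linear_order_on ?V ?R"
    using assms by (auto simp: is_ordered_graph_def)
  define rk where "rk v = card {w \<in> ?V. (w, v) \<in> ?R \<and> w \<noteq> v}" for v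
  have less: "rk v < rk w" if "v \<in> ?V" "w \<in> ?V" "(v, w) \<in> ?R" "v \<noteq> w" for v w
    unfolding rk_def
  proof (rule psubset_card_mono)
    show "{x \<in> ?V. (x, v) \<in> ?R \<and> x \<noteq> v} \<subset> {x \<in> ?V. (x, w) \<in> ?R \<and> x \<noteq> w}"
      using R that unfolding order_on_defs trans_def antisym_def by blast
  qed (use fin in simp)
  have le: "(v, w) \<in> ?R \<longleftrightarrow> rk v \<le> rk w" if "v \<in> ?V" "w \<in> ?V" for v w
  proof (cases "v = w")
    case True
    then show ?thesis using R that by (auto simp: order_on_defs refl_on_def)
  next
    case False
    then show ?thesis using less[of v w] less[of w v] that R
      unfolding order_on_defs total_on_def by (metis less_imp_le not_le)
  qed
  have inj: "inj_on rk ?V"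
    using le R unfolding order_on_defs antisym_def by (auto intro!: inj_onI)
  have "rk ` ?V \<subseteq> {..<card ?V}"
    unfolding rk_def using fin by (auto intro!: psubset_card_mono)
  then have "rk ` ?V = {..<card ?V}"
    using inj by (intro card_subset_eq) (auto simp: card_image)
  with inj have bij: "bij_betw rk ?V {..<card ?V}" by (simp add: bij_betw_def)
  let ?g = "inv_into ?V rk"
  have g: "?g i \<in> ?V" "rk (?g i) = i" if "i < card ?V" for i
    using bij that by (auto simp: bij_betw_def inv_into_into f_inv_into_f)
  have "order_enum F ?g"
    unfolding order_enum_def using bij_betw_inv_into[OF bij] le g by simp
  then show ?thesis by blast
qed

lemma order_enum_pairs:
  assumes "order_enum F g" "x \<in> verts F" "y \<in> verts F" "x \<noteq> y"
  obtains i j where "i < j" "j < card (verts F)" "x = g i \<and> y = g j \<or> x = g j \<and> y = g i"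
proof -
  have "verts F = g ` {..<card (verts F)}"
    using assms(1) by (simp add: order_enum_def bij_betw_def)
  then obtain i j where "i < card (verts F)" "j < card (verts F)" "x = g i" "y = g j"
    using assms(2,3) by (metis imageE lessThan_iff)
  with assms(4) that show ?thesis by (metis linorder_neqE_nat)
qed

lemma order_enum_inj:
  "order_enum F g \<Longrightarrow> i < card (verts F) \<Longrightarrow> j < card (verts F) \<Longrightarrow> g i = g j \<longleftrightarrow> i = j"
  by (auto simp: order_enum_def bij_betw_def inj_on_def)

lemma order_enum_mem: "order_enum F g \<Longrightarrow> i < card (verts F) \<Longrightarrow> g i \<in> verts F"
  by (auto simp: order_enum_def bij_betw_def)

lemma induced_copies_pair_graphD:
  assumes g: "order_enum F g" and f: "f \<in> induced_copies F (pair_graph n col)"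
    and ij: "i < j" "j < card (verts F)"
  shows "f (g i) < f (g j)" "f (g j) < n"
    "{g i, g j} \<in> edges F \<longleftrightarrow> col (f (g i)) (f (g j))"
proof -
  have mem: "g i \<in> verts F" "g j \<in> verts F" and ne: "g i \<noteq> g j"
    and ord: "(g i, g j) \<in> vorder F"
    using order_enum_mem[OF g] order_enum_inj[OF g] g ij by (auto simp: order_enum_def)
  have "f (g i) \<le> f (g j)" "f (g i) \<noteq> f (g j)" and n: "f (g j) < n"
    and e: "{g i, g j} \<in> edges F \<longleftrightarrow> {f (g i), f (g j)} \<in> edges (pair_graph n col)"
    using f mem ne ord by (auto simp: induced_copies_def inj_on_def)
  then show "f (g i) < f (g j)" "f (g j) < n" by auto
  with e show "{g i, g j} \<in> edges F \<longleftrightarrow> col (f (g i)) (f (g j))"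
    by (simp add: edge_pair_graph_iff)
qed

text \<open>Increasing index pairs suffice for the edge condition because edges are unordered. The
  lemma serves both the planted copies and the isomorphisms with the exceptional graphs.\<close>

lemma induced_copy_of_enum:
  fixes h :: "nat \<Rightarrow> 'b"
  assumes g: "order_enum F g"
    and h: "\<And>i. i < card (verts F) \<Longrightarrow> h i \<in> verts H"
    and ord: "\<And>i j. i \<le> j \<Longrightarrow> j < card (verts F) \<Longrightarrow> (h i, h j) \<in> vorder H"
    and inj: "inj_on h {..<card (verts F)}"
    and edges: "\<And>i j. i < j \<Longrightarrow> j < card (verts F) \<Longrightarrow>
      {g i, g j} \<in> edges F \<longleftrightarrow> {h i, h j} \<in> edges H"
  shows "restrict (h \<circ> inv_into {..<card (verts F)} g) (verts F) \<in> induced_copies F H"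
proof -
  let ?k = "card (verts F)"
  define f where "f = restrict (h \<circ> inv_into {..<?k} g) (verts F)"
  have img: "verts F = g ` {..<?k}" and inj_g: "inj_on g {..<?k}"
    using g by (auto simp: order_enum_def bij_betw_def)
  have f: "f (g i) = h i" if "i < ?k" for i
    using that order_enum_mem[OF g that] inj_g by (simp add: f_def inv_into_f_f)
  have "f \<in> verts F \<rightarrow>\<^sub>E verts H"
    using h f unfolding PiE_iff by (subst img) (auto simp: f_def)
  moreover have "inj_on f (verts F)"
    using inj f by (subst img) (auto simp: inj_on_def)
  moreover have "(f x, f y) \<in> vorder H" if xy: "x \<in> verts F" "y \<in> verts F" "(x, y) \<in> vorder F" for x y
  proof -
    obtain i j where "i < ?k" "j < ?k" "x = g i" "y = g j" using xy(1,2) img by (metis imageE lessThan_iff)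
    with xy(3) g f ord show ?thesis by (simp add: order_enum_def)
  qed
  moreover have "{x, y} \<in> edges F \<longleftrightarrow> {f x, f y} \<in> edges H"
    if xy: "x \<in> verts F" "y \<in> verts F" "x \<noteq> y" for x y
  proof -
    obtain i j where ij: "i < j" "j < ?k" "x = g i \<and> y = g j \<or> x = g j \<and> y = g i"
      using order_enum_pairs[OF g xy] .
    with edges[OF ij(1,2)] f[of i] f[of j] show ?thesis by (auto simp: insert_commute)
  qed
  ultimately show ?thesis
    unfolding induced_copies_def f_def[symmetric] by blast
qed

text \<open>Every one of the pairwise pair-disjoint copies must be destroyed by a change of its own.\<close>

lemma far_from_pair_disjoint_copies:
  fixes h :: "'i \<Rightarrow> nat \<Rightarrow> nat"
  assumes g: "order_enum F g"
    and less: "\<And>t i j. t \<in> I \<Longrightarrow> i < j \<Longrightarrow> j < card (verts F) \<Longrightarrow> h t i < h t j"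
    and bound: "\<And>t i. t \<in> I \<Longrightarrow> i < card (verts F) \<Longrightarrow> h t i < n"
    and copy: "\<And>t i j. t \<in> I \<Longrightarrow> i < j \<Longrightarrow> j < card (verts F) \<Longrightarrow>
      {g i, g j} \<in> edges F \<longleftrightarrow> col (h t i) (h t j)"
    and disjoint: "\<And>t t' i j i' j'. t \<in> I \<Longrightarrow> t' \<in> I \<Longrightarrow> i < j \<Longrightarrow> j < card (verts F) \<Longrightarrow>
      i' < j' \<Longrightarrow> j' < card (verts F) \<Longrightarrow> h t i = h t' i' \<Longrightarrow> h t j = h t' j' \<Longrightarrow> t = t'"
    and many: "\<epsilon> * (real n)\<^sup>2 \<le> real (card I)"
  shows "far_from_induced_free \<epsilon> F (pair_graph n col)"
  unfolding far_from_induced_free_def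
proof (intro allI impI)
  let ?G = "pair_graph n col" and ?k = "card (verts F)"
  fix H :: "nat ordered_graph"
  assume "is_ordered_graph H \<and> verts H = verts ?G \<and> vorder H = vorder ?G \<and> induced_free F H"
  then have H: "is_ordered_graph H" "verts H = {..<n}" "vorder H = {(u, v). u \<le> v \<and> v < n}"
    and free: "induced_copies F H = {}" by (auto simp: induced_free_def)
  let ?\<Delta> = "sym_diff (edges ?G) (edges H)"
  \<comment> \<open>If no pair of the copy \<open>h t\<close> were changed, the copy would survive
    in \<open>H\<close>.\<close>
  have "\<exists>i j. i < j \<and> j < ?k \<and> {h t i, h t j} \<in> ?\<Delta>" if t: "t \<in> I" for t
  proof (rule ccontr)
    assume no: "\<not> ?thesis"
    have "restrict (h t \<circ> inv_into {..<?k} g) (verts F) \<in> induced_copies F H"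
    proof (rule induced_copy_of_enum[OF g])
      show "inj_on (h t) {..<?k}"
        using less[OF t] by (intro inj_onI) (metis lessThan_iff linorder_neqE_nat less_irrefl)
      show "(h t i, h t j) \<in> vorder H" if "i \<le> j" "j < ?k" for i j
        using less[OF t, of i j] bound[OF t that(2)] that H by (cases "i = j") auto
      show "{g i, g j} \<in> edges F \<longleftrightarrow> {h t i, h t j} \<in> edges H" if "i < j" "j < ?k" for i j
        using copy[OF t that] no that edge_pair_graph_iff[OF less[OF t that] bound[OF t that(2)], of col]
        by blast
    qed (use bound[OF t] H in simp)
    with free show False by blast
  qed
  then obtain i j where ij: "\<And>t. t \<in> I \<Longrightarrow> i t < j t \<and> j t < ?k \<and> {h t (i t), h t (j t)} \<in> ?\<Delta>"
    by metis
  have "inj_on (\<lambda>t. {h t (i t), h t (j t)}) I"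
  proof (rule inj_onI)
    fix t t' assume tt: "t \<in> I" "t' \<in> I" and eq: "{h t (i t), h t (j t)} = {h t' (i t'), h t' (j t')}"
    have "h t (i t) < h t (j t)" "h t' (i t') < h t' (j t')" using less ij tt by auto
    with eq have "h t (i t) = h t' (i t')" "h t (j t) = h t' (j t')"
      by (auto simp: doubleton_eq_iff)
    with disjoint[OF tt] ij tt show "t = t'" by blast
  qed
  moreover have "(\<lambda>t. {h t (i t), h t (j t)}) ` I \<subseteq> ?\<Delta>" using ij by blast
  moreover have "finite ?\<Delta>"
  proof -
    have fin: "finite (edges K)" if "is_ordered_graph K" for K :: "nat ordered_graph"
    proof -
      have "edges K \<subseteq> Pow (verts K)" "finite (verts K)"
        using that by (auto simp: is_ordered_graph_def all_pairs_def)
      then show ?thesis by (meson finite_Pow_iff finite_subset)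
    qed
    from fin[OF H(1)] fin[OF is_ordered_graph_pair_graph] show ?thesis by simp
  qed
  ultimately have "card I \<le> card ?\<Delta>" by (rule card_inj_on_le)
  with many show "\<epsilon> * (real (card (verts ?G)))\<^sup>2 \<le> real (card ?\<Delta>)" by simp
qed

subsection \<open>The exceptional graphs\<close>

lemma ordered_iso_of_enum:
  assumes g: "order_enum F g" and g': "order_enum H g'" and card: "card (verts F) = card (verts H)"
    and edges: "\<And>i j. i < j \<Longrightarrow> j < card (verts F) \<Longrightarrow>
      {g i, g j} \<in> edges F \<longleftrightarrow> {g' i, g' j} \<in> edges H"
  shows "ordered_iso F H"
proof -
  let ?f = "restrict (g' \<circ> inv_into {..<card (verts F)} g) (verts F)"
  have "?f \<in> induced_copies F H"
    using g' edges card by (intro induced_copy_of_enum[OF g]) (auto simp: order_enum_def bij_betw_def)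
  moreover have "bij_betw (inv_into {..<card (verts F)} g) (verts F) {..<card (verts F)}"
    using g by (intro bij_betw_inv_into) (simp add: order_enum_def)
  then have "g' ` inv_into {..<card (verts F)} g ` verts F = verts H"
    using g' card by (simp add: order_enum_def bij_betw_def)
  then have "?f ` verts F = verts H" by (simp add: image_image)
  ultimately show ?thesis unfolding ordered_iso_def by blast
qed

lemma order_enum_D: "order_enum graph_D id"
proof -
  have "verts graph_D = {..<3}" by (auto simp: graph_D_def)
  then show ?thesis by (simp add: order_enum_def) (simp add: graph_D_def)
qed

lemma order_enum_D_reversal: "order_enum (order_reversal graph_D) (\<lambda>i. 2 - i)"
proof -
  have V: "verts (order_reversal graph_D) = {..<3}" by (auto simp: graph_D_def order_reversal_def)
  have "bij_betw (\<lambda>i. 2 - i) {..<3} {..<3 :: nat}"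
    by (rule bij_betw_byWitness[where f' = "\<lambda>i. 2 - i"]) auto
  moreover have "(2 - i, 2 - j) \<in> vorder (order_reversal graph_D) \<longleftrightarrow> i \<le> j"
    if "i < 3" "j < 3" for i j
    using that by (simp add: graph_D_def order_reversal_def) arith
  ultimately show ?thesis by (simp add: order_enum_def V)
qed

lemma order_enum_complement [simp]: "order_enum (complement F) g \<longleftrightarrow> order_enum F g"
  by (simp add: order_enum_def complement_def)

text \<open>With at least four vertices, two of the pairs \<open>01\<close>, \<open>12\<close>,
  \<open>23\<close> agree. With three, if \<open>01\<close> and \<open>12\<close> differ, the kinds
  of \<open>01\<close> and \<open>02\<close> leave four graphs, exactly the excluded ones.\<close>

lemma successive_pairs_alike:
  assumes g: "order_enum F g" and "3 \<le> card (verts F)"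
    and "\<not> ordered_iso F graph_D" "\<not> ordered_iso F (order_reversal graph_D)"
    and "\<not> ordered_iso F (complement graph_D)" "\<not> ordered_iso F (complement (order_reversal graph_D))"
  shows "\<exists>b. chain (\<lambda>i j. ({g i, g j} \<in> edges F) = b) 2 0 (card (verts F) - 1)"
proof -
  let ?k = "card (verts F)" and ?e = "\<lambda>i j. {g i, g j} \<in> edges F"
  have chain2: ?thesis if "x < y" "y \<le> z" "z < w" "w < ?k" "?e x y = ?e z w" for x y z w
  proof (intro exI)
    have "chain (\<lambda>i j. ?e i j = ?e x y) (Suc (Suc 0)) 0 (?k - 1)"
      using that by (intro chain_Suc[of 0 x y] chain_Suc[of y z w] chain_0) auto
    then show "chain (\<lambda>i j. ?e i j = ?e x y) 2 0 (?k - 1)" by (simp add: numeral_2_eq_2)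
  qed
  consider "?e 0 1 = ?e 1 2" | "?e 0 1 \<noteq> ?e 1 2" "4 \<le> ?k" | "?e 0 1 \<noteq> ?e 1 2" "?k = 3"
    using assms(2) by linarith
  then show ?thesis
  proof cases
    case 1
    then show ?thesis using assms(2) by (intro chain2[of 0 1 1 2]) simp_all
  next
    case 2
    then have "?e 0 1 = ?e 2 3 \<or> ?e 1 2 = ?e 2 3" by blast
    then show ?thesis
    proof
      assume "?e 0 1 = ?e 2 3"
      then show ?thesis using 2(2) by (intro chain2[of 0 1 2 3]) simp_all
    next
      assume "?e 1 2 = ?e 2 3"
      then show ?thesis using 2(2) by (intro chain2[of 1 2 2 3]) simp_all
    qed
  next
    case 3
    have iso: "ordered_iso F H"
      if "order_enum H h" "card (verts H) = 3"
        and e: "?e 0 1 \<longleftrightarrow> {h 0, h 1} \<in> edges H" "?e 0 2 \<longleftrightarrow> {h 0, h 2} \<in> edges H"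
          "?e 1 2 \<longleftrightarrow> {h 1, h 2} \<in> edges H"
      for H :: "nat ordered_graph" and h
    proof (rule ordered_iso_of_enum[OF g that(1)])
      fix i j assume "i < j" "j < ?k"
      with 3(2) have "i = 0 \<and> j = 1 \<or> i = 0 \<and> j = 2 \<or> i = 1 \<and> j = 2" by arith
      with e show "?e i j \<longleftrightarrow> {h i, h j} \<in> edges H" by blast
    qed (simp only: that(2) 3(2))
    have all: "{x, y} \<in> all_pairs V \<longleftrightarrow> x \<in> V \<and> y \<in> V \<and> x \<noteq> y" for x y :: nat and V
      by (auto simp: all_pairs_def doubleton_eq_iff)
    note simps = graph_D_def order_reversal_def complement_def all doubleton_eq_iff
    have "ordered_iso F graph_D" if "?e 0 1" "?e 0 2" "\<not> ?e 1 2"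
      by (rule iso[OF order_enum_D]) (use that in \<open>simp_all add: simps\<close>)
    moreover have "ordered_iso F (order_reversal graph_D)" if "\<not> ?e 0 1" "?e 0 2" "?e 1 2"
      by (rule iso[OF order_enum_D_reversal]) (use that in \<open>simp_all add: simps\<close>)
    moreover have "ordered_iso F (complement graph_D)" if "\<not> ?e 0 1" "\<not> ?e 0 2" "?e 1 2"
      by (rule iso[OF order_enum_complement[THEN iffD2, OF order_enum_D]])
        (use that in \<open>simp_all add: simps\<close>)
    moreover have "ordered_iso F (complement (order_reversal graph_D))"
      if "?e 0 1" "\<not> ?e 0 2" "\<not> ?e 1 2"
      by (rule iso[OF order_enum_complement[THEN iffD2, OF order_enum_D_reversal]])
        (use that in \<open>simp_all add: simps\<close>)
    ultimately have False using assms(3-6) 3(1) by blast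
    then show ?thesis ..
  qed
qed

subsection \<open>Putting everything together\<close>

text \<open>Progressions \<open>(x, d)\<close> of positions are combined with progressions
  \<open>(y, e)\<close> of block numbers, which multiplies the number of pair-disjoint copies by
  \<open>k * Q\<^sup>2\<close>. The factor \<open>k ^ 3\<close> bounds the number of index triples
  that may form the Behrend triangle.\<close>

lemma (in pattern) host_graph_exists:
  fixes F :: "'a ordered_graph" and n L :: nat
  assumes fin: "finite (verts F)" and g: "order_enum F g" and k: "card (verts F) = k"
    and E: "\<And>i j. i < j \<Longrightarrow> j < k \<Longrightarrow> E i j \<longleftrightarrow> (({g i, g j} \<in> edges F) = b)"
    and S: "convex_free k S" "S \<subseteq> {..<L}"
  defines "N \<equiv> 2 * k * L"
  defines "Q \<equiv> n div (2 * k\<^sup>2 * N)"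
  assumes Q: "0 < Q"
  shows "\<exists>G :: nat ordered_graph. is_ordered_graph G \<and> card (verts G) = n \<and>
    (\<forall>\<epsilon>. \<epsilon> * (real n)\<^sup>2 \<le> real (k\<^sup>2 * L * card S * Q\<^sup>2) \<longrightarrow> far_from_induced_free \<epsilon> F G) \<and>
    card (induced_copies F G) \<le> k ^ 3 * (n ^ (k - 1) * (n div N + 1))"
proof -
  \<comment> \<open>A part consists of \<open>W\<close> blocks of length \<open>N\<close>. The
    factor 2 in \<open>W\<close> and \<open>N\<close> leaves room for a starting value and fewer
    than \<open>k\<close> steps, so nothing wraps around.\<close>
  define W where "W = 2 * k * Q"
  define m where "m = W * N"
  \<comment> \<open>The minimum puts the vertices left over by the division into the last
    part.\<close>
  define part where "part u = min (u div m) (k - 1)" for u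
  define col where "col u v \<longleftrightarrow> host_adj S (part u) (part v) (u mod N) (v mod N) = b" for u v
  let ?G = "pair_graph n col"
  define I where "I = {..<k * L} \<times> S \<times> {..<k * Q} \<times> {..<Q}"
  define h where "h = (\<lambda>(x, d, y, e) j. (j * W + (y + j * e)) * N + (x + j * d))"
  have pos: "0 < N" "0 < W" "0 < m"
    using Q by (auto simp: Q_def W_def m_def intro!: Nat.gr0I)
  have h: "h (x, d, y, e) j mod N = x + j * d" "h (x, d, y, e) j div m = j"
    "h (x, d, y, e) j div N mod W = y + j * e" "h (x, d, y, e) j < n"
    if t: "(x, d, y, e) \<in> I" and j: "j < k" for x d y e j
  proof -
    have "j * d \<le> k * L" "j * e \<le> k * Q"
      using t j S(2) by (intro mult_mono; force simp: I_def)+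
    moreover have "x < k * L" "y < k * Q" using t by (auto simp: I_def)
    ultimately have low: "x + j * d < N" "y + j * e < W" by (auto simp: N_def W_def)
    have hd: "h (x, d, y, e) j div N = j * W + (y + j * e)"
      and hm: "h (x, d, y, e) j mod N = x + j * d"
      using low(1) by (auto simp: h_def)
    show "h (x, d, y, e) j mod N = x + j * d" by fact
    show "h (x, d, y, e) j div N mod W = y + j * e" using low(2) by (simp add: hd)
    show dm: "h (x, d, y, e) j div m = j"
      using low(2) by (simp add: m_def mult.commute[of W] div_mult2_eq hd)
    have "h (x, d, y, e) j < (j + 1) * m"
      using dividend_less_div_times[OF pos(3), of "h (x, d, y, e) j"] dm by simp
    also have "\<dots> \<le> k * m" using j by (intro mult_right_mono) auto
    also have "\<dots> = Q * (2 * k\<^sup>2 * N)" by (simp add: m_def W_def power2_eq_square)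
    also have "\<dots> \<le> n" unfolding Q_def by (rule div_times_less_eq_dividend)
    finally show "h (x, d, y, e) j < n" .
  qed
  have hmono: "h t i < h t j" if "t \<in> I" "i < j" "j < k" for t i j
  proof -
    obtain x d y e where t: "t = (x, d, y, e)" by (cases t)
    have "h t i div m < h t j div m" using h(2)[of x d y e] that by (simp add: t)
    then show ?thesis by (meson div_le_mono not_le)
  qed
  have far: "far_from_induced_free \<epsilon> F ?G"
    if \<epsilon>: "\<epsilon> * (real n)\<^sup>2 \<le> real (k\<^sup>2 * L * card S * Q\<^sup>2)" for \<epsilon>
  proof (rule far_from_pair_disjoint_copies[OF g, where I = I and h = h, unfolded k])
    show "\<epsilon> * (real n)\<^sup>2 \<le> real (card I)"
      using \<epsilon> by (simp add: I_def card_cartesian_product power2_eq_square mult_ac)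
    show "h t i < n" if "t \<in> I" "i < k" for t i
      using h(4) that by (cases t) blast
    show "h t i < h t j" if "t \<in> I" "i < j" "j < k" for t i j
      using hmono that by blast
    show "{g i, g j} \<in> edges F \<longleftrightarrow> col (h t i) (h t j)" if t: "t \<in> I" and ij: "i < j" "j < k" for t i j
    proof -
      obtain x d y e where [simp]: "t = (x, d, y, e)" by (cases t)
      have "part (h t i) = i" "part (h t j) = j"
        using h(2)[of x d y e] t ij by (auto simp: part_def)
      moreover have "behrend_pair S i j (h t i mod N) (h t j mod N)"
        using h(1)[of x d y e] t ij by (auto simp: behrend_pair_def I_def)
      ultimately show ?thesis
        using host_adj_behrend_pair[OF ij(1)] E[OF ij] by (auto simp: col_def)
    qed
    show "t = t'"
      if t: "t \<in> I" "t' \<in> I" and ij: "i < j" "j < k" "i' < j'" "j' < k"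
        and eq: "h t i = h t' i'" "h t j = h t' j'" for t t' i j i' j'
    proof -
      obtain x d y e where [simp]: "t = (x, d, y, e)" by (cases t)
      obtain x' d' y' e' where [simp]: "t' = (x', d', y', e')" by (cases t')
      note ht = h[OF t(1)[simplified]] and ht' = h[OF t(2)[simplified]]
      have "i < k" "i' < k" using ij by auto
      \<comment> \<open>Quotients by \<open>m\<close> reveal the indices. Two terms of a progression
        then determine its start and difference, for positions and block numbers alike.\<close>
      then have [simp]: "i' = i" "j' = j"
        using ht(2)[of i] ht'(2)[of i'] ht(2)[of j] ht'(2)[of j'] ij eq by auto
      have affine: "u = u' \<and> v = v'" if "u + i * v = u' + i * v'" "u + j * v = u' + j * v'"
        for u v u' v' :: nat
      proof -
        obtain a where a: "j = i + a" "0 < a" using ij by (metis less_imp_add_positive)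
        have "u + i * v + a * v = u' + i * v' + a * v'"
          using that(2) unfolding a(1) by (simp only: distrib_right add.assoc)
        with that(1) have "a * v = a * v'" by linarith
        with a(2) that(1) show ?thesis by simp
      qed
      have "x = x' \<and> d = d'"
        using ht(1)[of i] ht'(1)[of i] ht(1)[of j] ht'(1)[of j] ij eq by (intro affine) auto
      moreover have "y = y' \<and> e = e'"
        using ht(3)[of i] ht'(3)[of i] ht(3)[of j] ht'(3)[of j] ij eq by (intro affine) auto
      ultimately show "t = t'" by simp
    qed
  qed
  define T where "T = {(i, j, l). i < j \<and> j < l \<and> l < k}"
  define R where "R = (\<lambda>(i, j, l). {f \<in> verts F \<rightarrow>\<^sub>E {..<n}.
    (j - i) * (f (g l) mod N) + (l - j) * (f (g i) mod N) = (l - i) * (f (g j) mod N)})"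
  have T: "T \<subseteq> {..<k} \<times> {..<k} \<times> {..<k}" by (auto simp: T_def)
  then have finT: "finite T" by (rule finite_subset) simp
  have cardT: "card T \<le> k ^ 3"
    using card_mono[OF _ T] by (simp add: card_cartesian_product power3_eq_cube)
  have "induced_copies F ?G \<subseteq> (\<Union>t\<in>T. R t)"
  proof
    fix f assume f: "f \<in> induced_copies F ?G"
    note fD = induced_copies_pair_graphD[OF g f, unfolded k]
    have "\<exists>i j l. i < j \<and> j < l \<and> l < k \<and>
      (j - i) * (f (g l) mod N) + (l - j) * (f (g i) mod N) = (l - i) * (f (g j) mod N)"
    proof (rule copy_contains_behrend_triangle[OF S(1)])
      show "part (f (g i)) < k" for i using k_pos by (simp add: part_def)
      show "part (f (g i)) \<le> part (f (g j))" if "i \<le> j" "j < k" for i j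
      proof -
        have "f (g i) \<le> f (g j)" using fD(1)[of i j] that by (cases "i = j") auto
        then show ?thesis unfolding part_def by (intro min.mono div_le_mono order_refl)
      qed
      show "E i j \<longleftrightarrow> host_adj S (part (f (g i))) (part (f (g j))) (f (g i) mod N) (f (g j) mod N)"
        if "i < j" "j < k" for i j
        using fD(3)[OF that] E[OF that] by (auto simp: col_def)
    qed
    then obtain i j l where "(i, j, l) \<in> T" and
      rel: "(j - i) * (f (g l) mod N) + (l - j) * (f (g i) mod N) = (l - i) * (f (g j) mod N)"
      unfolding T_def by blast
    moreover have "f \<in> verts F \<rightarrow>\<^sub>E {..<n}" using f by (simp add: induced_copies_def)
    with rel have "f \<in> R (i, j, l)" by (simp only: R_def case_prod_conv mem_Collect_eq)
    ultimately show "f \<in> (\<Union>t\<in>T. R t)" by blast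
  qed
  moreover have "finite (\<Union>t\<in>T. R t)"
    using finT fin by (auto simp: R_def intro!: finite_PiE)
  ultimately have "card (induced_copies F ?G) \<le> card (\<Union>t\<in>T. R t)" by (intro card_mono)
  also have "\<dots> \<le> (\<Sum>t\<in>T. card (R t))" by (rule card_UN_le[OF finT])
  also have "\<dots> \<le> of_nat (card T) * (n ^ (k - 1) * (n div N + 1))"
  proof (rule sum_bounded_above)
    fix t assume "t \<in> T"
    then obtain i j l where t: "t = (i, j, l)" "i < j" "j < l" "l < k" by (auto simp: T_def)
    then show "card (R t) \<le> n ^ (k - 1) * (n div N + 1)"
      using card_linear_relation_le[OF fin, where x = "g i" and y = "g j" and z = "g l" and a = "j - i" and
          b = "l - j" and c = "l - i" and n = n and N = N]
        order_enum_mem[OF g] order_enum_inj[OF g] by (simp add: R_def k)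
  qed
  also have "\<dots> \<le> k ^ 3 * (n ^ (k - 1) * (n div N + 1))" using cardT by simp
  finally show ?thesis using far is_ordered_graph_pair_graph by (intro exI[of _ ?G]) simp
qed

text \<open>
  With \<open>t = ln (1 / \<epsilon>)\<close> the dimension \<open>D\<close> is of order \<open>t\<close>, so that \<open>2 ^ D\<^sup>2\<close>
  beats \<open>exp (c t\<^sup>2) = (1 / \<epsilon>) powr (c t)\<close>.
\<close>

lemma behrend_dimension:
  fixes k :: nat
  assumes "0 < k"
  shows "\<exists>c>0. \<exists>\<epsilon>\<^sub>0>0. \<forall>\<epsilon>::real. 0 < \<epsilon> \<and> \<epsilon> < \<epsilon>\<^sub>0 \<longrightarrow>
    (\<exists>D>0. \<epsilon> * (64 * real k ^ 4 * (8 * real k) ^ D) \<le> 1 \<and>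
      (real k)\<^sup>2 / 2 ^ (D * D) \<le> \<epsilon> powr (c * ln (1 / \<epsilon>)))"
proof -
  \<comment> \<open>In logarithms the first requirement is \<open>A + D * \<mu> \<le> t\<close>.
    With this \<open>c\<close>, a dimension above \<open>t / (2 * \<mu>)\<close> gives
    \<open>D\<^sup>2 * ln 2 > 2 * c * t\<^sup>2\<close>, half of which pays for
    \<open>k\<^sup>2\<close>.\<close>
  define A \<mu> c where "A = ln (64 * real k ^ 4)" and "\<mu> = ln (8 * real k)" and "c = ln 2 / (8 * \<mu>\<^sup>2)"
  have k1: "1 \<le> real k" using assms by simp
  have \<mu>: "0 < \<mu>" unfolding \<mu>_def using k1 by (intro ln_gt_zero) linarith
  have c: "0 < c" unfolding c_def using \<mu> by simp
  have A: "0 \<le> A" unfolding A_def using one_le_power[OF k1, of 4] by simp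
  \<comment> \<open>The three bounds yield \<open>t \<le> t\<^sup>2\<close>, make up for
    \<open>A\<close> and the rounding in \<open>D\<close>, and let \<open>c * t\<^sup>2\<close>
    absorb \<open>2 * ln k\<close>.\<close>
  define t\<^sub>0 where "t\<^sub>0 = Max {1, 2 * \<mu> + 2 * A, 2 * ln k / c}"
  have t\<^sub>0: "1 \<le> t\<^sub>0" "2 * \<mu> + 2 * A \<le> t\<^sub>0" "2 * ln k / c \<le> t\<^sub>0" by (auto simp: t\<^sub>0_def)
  have "\<exists>D>0. \<epsilon> * (64 * real k ^ 4 * (8 * real k) ^ D) \<le> 1 \<and>
      (real k)\<^sup>2 / 2 ^ (D * D) \<le> \<epsilon> powr (c * ln (1 / \<epsilon>))" if \<epsilon>: "0 < \<epsilon>" "\<epsilon> < exp (- t\<^sub>0)" for \<epsilon>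
  proof -
    define t where "t = - ln \<epsilon>"
    have \<epsilon>t: "\<epsilon> = exp (- t)" using \<epsilon> by (simp add: t_def)
    have t: "t\<^sub>0 < t" using \<epsilon>(2) by (simp add: \<epsilon>t)
    define D where "D = nat \<lfloor>(t - A) / \<mu>\<rfloor>"
    have nonneg: "0 \<le> (t - A) / \<mu>" using t t\<^sub>0 \<mu> A by (intro divide_nonneg_pos) auto
    have "real D \<le> (t - A) / \<mu>" unfolding D_def using nonneg by simp
    then have up: "A + real D * \<mu> \<le> t" using \<mu> by (simp add: field_simps)
    have "(t - A) / \<mu> - 1 < real D" unfolding D_def using nonneg by linarith
    moreover have "t / (2 * \<mu>) \<le> (t - A) / \<mu> - 1"
      using t t\<^sub>0 \<mu> by (simp add: field_simps)
    ultimately have low: "t / (2 * \<mu>) < real D" by linarith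
    moreover have "0 < t / (2 * \<mu>)" using t t\<^sub>0 \<mu> by (intro divide_pos_pos) auto
    ultimately have "0 < D" by (metis less_trans of_nat_0_less_iff)
    have "64 * real k ^ 4 * (8 * real k) ^ D = exp (A + real D * \<mu>)"
      using k1 by (simp add: A_def \<mu>_def exp_add exp_of_nat_mult)
    also have "\<dots> \<le> exp t" using up by simp
    finally have small: "\<epsilon> * (64 * real k ^ 4 * (8 * real k) ^ D) \<le> 1"
      by (simp add: \<epsilon>t exp_minus field_simps)
    have "(t / (2 * \<mu>))\<^sup>2 \<le> (real D)\<^sup>2" using low \<open>0 < t / (2 * \<mu>)\<close> by (intro power_mono) auto
    then have "(t / (2 * \<mu>))\<^sup>2 * ln 2 \<le> (real D)\<^sup>2 * ln 2" by (intro mult_right_mono) auto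
    moreover have "(t / (2 * \<mu>))\<^sup>2 * ln 2 = 2 * c * t\<^sup>2"
      using \<mu> by (simp add: c_def field_simps power2_eq_square)
    moreover have "2 * ln k \<le> c * t\<^sup>2"
    proof -
      have "2 * ln k \<le> c * t\<^sub>0" using t\<^sub>0(3) c by (simp add: field_simps)
      also have "\<dots> \<le> c * t\<^sup>2"
        using t t\<^sub>0(1) c mult_mono[of 1 t t\<^sub>0 t] by (intro mult_left_mono) (auto simp: power2_eq_square)
      finally show ?thesis .
    qed
    ultimately have "2 * ln k - (real D)\<^sup>2 * ln 2 \<le> - (c * t\<^sup>2)" by linarith
    moreover have "(real k)\<^sup>2 / 2 ^ (D * D) = exp (2 * ln k - (real D)\<^sup>2 * ln 2)"
    proof -
      have "(2::real) ^ (D * D) = exp (real (D * D) * ln 2)"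
        by (simp add: exp_of_nat_mult del: of_nat_mult)
      moreover have "(real k)\<^sup>2 = exp (2 * ln k)"
        using k1 exp_of_nat_mult[of 2 "ln k"] by simp
      ultimately show ?thesis by (simp add: exp_diff power2_eq_square)
    qed
    moreover have "\<epsilon> powr (c * ln (1 / \<epsilon>)) = exp (- (c * t\<^sup>2))"
      using \<epsilon>(1) by (simp add: powr_def t_def ln_div power2_eq_square mult_ac)
    ultimately show ?thesis using small \<open>0 < D\<close> by auto
  qed
  with c show ?thesis by (intro exI[of _ c] conjI exI[of _ "exp (- t\<^sub>0)"]) auto
qed

theorem theorem3p7:
  fixes F :: "'a ordered_graph"
  assumes "is_ordered_graph F"
    and "card (verts F) \<ge> 3"
    and "\<not> ordered_iso F graph_D"
    and "\<not> ordered_iso F (order_reversal graph_D)"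
    and "\<not> ordered_iso F (complement graph_D)"
    and "\<not> ordered_iso F (complement (order_reversal graph_D))"
  shows "\<exists>c::real. c > 0 \<and> (\<exists>\<epsilon>\<^sub>0::real. \<epsilon>\<^sub>0 > 0 \<and>
    (\<forall>\<epsilon>::real. 0 < \<epsilon> \<and> \<epsilon> < \<epsilon>\<^sub>0 \<longrightarrow>
      (\<exists>n\<^sub>0::nat. \<forall>n::nat. n > n\<^sub>0 \<longrightarrow>
        (\<exists>G :: nat ordered_graph.
           is_ordered_graph G \<and> card (verts G) = n \<and>
           far_from_induced_free \<epsilon> F G \<and>
           real (card (induced_copies F G))
             \<le> \<epsilon> powr (c * ln (1 / \<epsilon>)) * real n ^ card (verts F)))))"
proof -
  obtain g where g: "order_enum F g" using order_enum_exists[OF assms(1)] by blast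
  define k where "k = card (verts F)"
  have k: "0 < k" using assms(2) by (simp add: k_def)
  obtain b where b: "chain (\<lambda>i j. ({g i, g j} \<in> edges F) = b) 2 0 (k - 1)"
    using successive_pairs_alike[OF g assms(2-6)] by (auto simp: k_def)
  \<comment> \<open>Comparison with \<open>b\<close> treats edges and non-edges as pattern pairs
    alike.\<close>
  then interpret pattern k "\<lambda>i j. ({g i, g j} \<in> edges F) = b" by unfold_locales
  obtain c \<epsilon>\<^sub>0 where c: "0 < c" "0 < \<epsilon>\<^sub>0" and dim: "\<And>\<epsilon>::real. 0 < \<epsilon> \<Longrightarrow> \<epsilon> < \<epsilon>\<^sub>0 \<Longrightarrow>
    \<exists>D>0. \<epsilon> * (64 * real k ^ 4 * (8 * real k) ^ D) \<le> 1 \<and>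
      (real k)\<^sup>2 / 2 ^ (D * D) \<le> \<epsilon> powr (c * ln (1 / \<epsilon>))"
    using behrend_dimension[OF k] by blast
  have "\<exists>n\<^sub>0::nat. \<forall>n>n\<^sub>0. \<exists>G :: nat ordered_graph. is_ordered_graph G \<and> card (verts G) = n \<and>
      far_from_induced_free \<epsilon> F G \<and>
      real (card (induced_copies F G)) \<le> \<epsilon> powr (c * ln (1 / \<epsilon>)) * real n ^ k"
    if \<epsilon>: "0 < \<epsilon>" "\<epsilon> < \<epsilon>\<^sub>0" for \<epsilon>
  proof -
    obtain D where D: "0 < D" "\<epsilon> * (64 * real k ^ 4 * (8 * real k) ^ D) \<le> 1"
      "(real k)\<^sup>2 / 2 ^ (D * D) \<le> \<epsilon> powr (c * ln (1 / \<epsilon>))"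
      using dim[OF \<epsilon>] by blast
    define L where "L = (k * 2 ^ D) ^ D"
    obtain S where S: "S \<subseteq> {..<L}" "convex_free k S" and LS: "L \<le> card S * (8 * k) ^ D"
      using behrend[OF k D(1)] unfolding L_def by blast
    have Lpos: "0 < L" using k by (simp add: L_def)
    define N where "N = 2 * k * L"
    have Npos: "0 < N" using k Lpos by (simp add: N_def)
    have "\<exists>G :: nat ordered_graph. is_ordered_graph G \<and> card (verts G) = n \<and>
      far_from_induced_free \<epsilon> F G \<and>
      real (card (induced_copies F G)) \<le> \<epsilon> powr (c * ln (1 / \<epsilon>)) * real n ^ k"
      if n: "2 * k\<^sup>2 * N < n" for n
    proof -
      define Q where "Q = n div (2 * k\<^sup>2 * N)"
      have pos: "0 < 2 * k\<^sup>2 * N" using k Npos by simp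
      have Q: "0 < Q" using n pos by (simp add: Q_def div_greater_zero_iff)
      obtain G :: "nat ordered_graph" where G: "is_ordered_graph G" "card (verts G) = n"
        and far: "\<epsilon> * (real n)\<^sup>2 \<le> real (k\<^sup>2 * L * card S * Q\<^sup>2) \<Longrightarrow> far_from_induced_free \<epsilon> F G"
        and copies: "card (induced_copies F G) \<le> k ^ 3 * (n ^ (k - 1) * (n div N + 1))"
        using host_graph_exists[OF _ g k_def[symmetric] refl S(2,1), of n] Q assms(1)
        by (auto simp: Q_def N_def is_ordered_graph_def)
      \<comment> \<open>As \<open>Q\<close> is positive, rounding down costs at most a factor
        2.\<close>
      have "n \<le> 2 * k\<^sup>2 * N * (Q + 1)"
        using dividend_less_div_times[OF pos, of n] by (simp add: Q_def algebra_simps)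
      also have "\<dots> \<le> 2 * k\<^sup>2 * N * (2 * Q)" using Q by (intro mult_left_mono) auto
      finally have "real n \<le> real (8 * k ^ 3 * L * Q)"
        unfolding N_def by (subst of_nat_le_iff) (simp add: power2_eq_square power3_eq_cube mult_ac)
      then have "(real n)\<^sup>2 \<le> (8 * real k ^ 3 * real L * real Q)\<^sup>2"
        by (intro power_mono) auto
      then have "\<epsilon> * (real n)\<^sup>2 \<le> \<epsilon> * (8 * real k ^ 3 * real L * real Q)\<^sup>2"
        using \<epsilon> by (intro mult_left_mono) auto
      also have "\<dots> = (\<epsilon> * (64 * real k ^ 4)) * real L * ((real k)\<^sup>2 * real L * (real Q)\<^sup>2)"
        by (simp add: power_mult_distrib eval_nat_numeral)
      \<comment> \<open>One factor \<open>L\<close> is traded for \<open>card S\<close>; the Behrend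
        loss \<open>(8 * k) ^ D\<close> is compensated by \<epsilon> through the choice of
        \<open>D\<close>.\<close>
      also have "\<dots> \<le> (\<epsilon> * (64 * real k ^ 4)) * (real (card S) * (8 * real k) ^ D)
          * ((real k)\<^sup>2 * real L * (real Q)\<^sup>2)"
      proof (intro mult_right_mono mult_left_mono)
        have "real L \<le> real (card S * (8 * k) ^ D)" using LS by (rule of_nat_mono)
        then show "real L \<le> real (card S) * (8 * real k) ^ D" by simp
      qed (use \<epsilon> in auto)
      also have "\<dots> = (\<epsilon> * (64 * real k ^ 4 * (8 * real k) ^ D)) * real (k\<^sup>2 * L * card S * Q\<^sup>2)"
        by (simp add: mult_ac)
      also have "\<dots> \<le> 1 * real (k\<^sup>2 * L * card S * Q\<^sup>2)"
        using D(2) by (intro mult_right_mono) auto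
      finally have farG: "far_from_induced_free \<epsilon> F G" using far by simp
      have "N \<le> 2 * k\<^sup>2 * N" using k by simp
      \<comment> \<open>This lets the summand 1 in the size of a residue class be absorbed by a
        factor 2.\<close>
      then have "N \<le> n" using n by linarith
      have "real (n div N + 1) \<le> real n / real N + 1" using of_nat_div_le_of_nat[of n N] by simp
      also have "\<dots> \<le> 2 * real n / real N"
        using \<open>N \<le> n\<close> Npos by (simp add: field_simps)
      finally have quot: "real (n div N + 1) \<le> 2 * real n / real N" .
      \<comment> \<open>The saving is quadratic in \<open>D\<close> in the exponent while the
        Behrend loss is only linear there; hence the superpolynomial bound.\<close>
      have "2 ^ (D * D) \<le> L"
        using k by (simp add: L_def power_mult_distrib power_mult)
      then have LD: "2 ^ (D * D) \<le> real L" by (metis of_nat_le_iff of_nat_numeral of_nat_power)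
      have "real (card (induced_copies F G)) \<le> real (k ^ 3 * (n ^ (k - 1) * (n div N + 1)))"
        using copies by (rule of_nat_mono)
      also have "\<dots> = real k ^ 3 * (real n ^ (k - 1) * real (n div N + 1))"
        by (simp only: of_nat_mult of_nat_power)
      also have "\<dots> \<le> real k ^ 3 * (real n ^ (k - 1) * (2 * real n / real N))"
        using quot by (intro mult_left_mono) auto
      also have "\<dots> = (real k)\<^sup>2 / real L * (real n ^ (k - 1) * real n)"
        using k by (simp add: N_def field_simps eval_nat_numeral)
      also have "real n ^ (k - 1) * real n = real n ^ k"
        using k by (metis Suc_diff_1 power_Suc2)
      also have "(real k)\<^sup>2 / real L * real n ^ k \<le> (real k)\<^sup>2 / 2 ^ (D * D) * real n ^ k"
        using LD Lpos by (intro mult_right_mono divide_left_mono) auto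
      also have "\<dots> \<le> \<epsilon> powr (c * ln (1 / \<epsilon>)) * real n ^ k"
        using D(3) by (intro mult_right_mono) auto
      finally show ?thesis using G farG by blast
    qed
    then show ?thesis by blast
  qed
  with c show ?thesis unfolding k_def by blast
qed

end
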